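(* If $G$ and $G'$ are non-isomorphic graphs both of order $n$, then $\mathrm{D}(G,G')\le (n+3)/2$.
   Context: Graphs are finite, undirected and loopless; the order of a graph is its number of vertices. A graph is regarded as a structure with a single irreflexive symmetric binary predicate $E$ (adjacency). First order formulas use the predicate symbols $E$ and $=$ and the connectives $\neg,\wedge,\vee$; quantifiers range over vertices. A closed formula $\Phi$ distinguishes $G$ from $G'$ if $\Phi$ is true on $G$ and false on $G'$. The quantifier rank of $\Phi$ is the maximum number of nested quantifiers in $\Phi$. For non-isomorphic $G,G'$, $\mathrm{D}(G,G')$ denotes the minimum quantifier rank of a formula distinguishing $G$ from $G'$. *)

theory Defs
  imports Complex_Main "Graph_Theory.Graph_Theory"
begin

text \<open>Graphs are the locale \<open>pair_graph\<close>: a finite vertex set \<open>pverts G\<close>, and an adjacency relation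
  \<open>parcs G\<close> on it that is irreflexive and symmetric.\<close>

subsection \<open>First order formulas over adjacency and equality\<close>

text \<open>Variables are natural numbers.\<close>

datatype fo_formula =
    Adj nat nat
  | Eq nat nat
  | Neg fo_formula
  | Conj fo_formula fo_formula
  | Disj fo_formula fo_formula
  | Ex nat fo_formula
  | All nat fo_formula

primrec free_vars :: "fo_formula \<Rightarrow> nat set" where
  "free_vars (Adj x y) = {x, y}"
| "free_vars (Eq x y) = {x, y}"
| "free_vars (Neg \<phi>) = free_vars \<phi>"
| "free_vars (Conj \<phi> \<psi>) = free_vars \<phi> \<union> free_vars \<psi>"
| "free_vars (Disj \<phi> \<psi>) = free_vars \<phi> \<union> free_vars \<psi>"
| "free_vars (Ex x \<phi>) = free_vars \<phi> - {x}"
| "free_vars (All x \<phi>) = free_vars \<phi> - {x}"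

definition closed_formula :: "fo_formula \<Rightarrow> bool" where
  "closed_formula \<phi> \<longleftrightarrow> free_vars \<phi> = {}"

primrec quantifier_rank :: "fo_formula \<Rightarrow> nat" where
  "quantifier_rank (Adj x y) = 0"
| "quantifier_rank (Eq x y) = 0"
| "quantifier_rank (Neg \<phi>) = quantifier_rank \<phi>"
| "quantifier_rank (Conj \<phi> \<psi>) = max (quantifier_rank \<phi>) (quantifier_rank \<psi>)"
| "quantifier_rank (Disj \<phi> \<psi>) = max (quantifier_rank \<phi>) (quantifier_rank \<psi>)"
| "quantifier_rank (Ex x \<phi>) = Suc (quantifier_rank \<phi>)"
| "quantifier_rank (All x \<phi>) = Suc (quantifier_rank \<phi>)"

primrec sat :: "'a pair_pre_digraph \<Rightarrow> (nat \<Rightarrow> 'a) \<Rightarrow> fo_formula \<Rightarrow> bool" where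
  "sat G e (Adj x y) \<longleftrightarrow> (e x, e y) \<in> parcs G"
| "sat G e (Eq x y) \<longleftrightarrow> e x = e y"
| "sat G e (Neg \<phi>) \<longleftrightarrow> \<not> sat G e \<phi>"
| "sat G e (Conj \<phi> \<psi>) \<longleftrightarrow> sat G e \<phi> \<and> sat G e \<psi>"
| "sat G e (Disj \<phi> \<psi>) \<longleftrightarrow> sat G e \<phi> \<or> sat G e \<psi>"
| "sat G e (Ex x \<phi>) \<longleftrightarrow> (\<exists>v \<in> pverts G. sat G (e(x := v)) \<phi>)"
| "sat G e (All x \<phi>) \<longleftrightarrow> (\<forall>v \<in> pverts G. sat G (e(x := v)) \<phi>)"

text \<open>The assignment in \<open>true_on\<close> ranges over the whole type rather than over \<open>pverts G\<close>, so that truth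
  is not vacuous on the graph of order 0. It is immaterial for closed formulas, see \<open>true_on_iff\<close>.\<close>

definition true_on :: "fo_formula \<Rightarrow> 'a pair_pre_digraph \<Rightarrow> bool" where
  "true_on \<phi> G \<longleftrightarrow> (\<forall>e. sat G e \<phi>)"

lemma sat_cong: "\<forall>x \<in> free_vars \<phi>. e x = e' x \<Longrightarrow> sat G e \<phi> = sat G e' \<phi>"
proof (induction \<phi> arbitrary: e e')
  case (Neg \<phi>)
  then show ?case by (simp only: free_vars.simps sat.simps)
next
  case (Conj \<phi> \<psi>)
  then have "sat G e \<phi> = sat G e' \<phi>" "sat G e \<psi> = sat G e' \<psi>" by (auto simp del: sat.simps)
  then show ?case by simp
next
  case (Disj \<phi> \<psi>)
  then have "sat G e \<phi> = sat G e' \<phi>" "sat G e \<psi> = sat G e' \<psi>" by (auto simp del: sat.simps)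
  then show ?case by simp
next
  case (Ex x \<phi>)
  have "sat G (e(x := v)) \<phi> = sat G (e'(x := v)) \<phi>" for v
    using Ex.prems by (intro Ex.IH) auto
  then show ?case by simp
next
  case (All x \<phi>)
  have "sat G (e(x := v)) \<phi> = sat G (e'(x := v)) \<phi>" for v
    using All.prems by (intro All.IH) auto
  then show ?case by simp
qed auto

lemma true_on_iff: "closed_formula \<phi> \<Longrightarrow> true_on \<phi> G \<longleftrightarrow> sat G e \<phi>"
  unfolding true_on_def closed_formula_def using sat_cong by blast

definition distinguishes ::
    "fo_formula \<Rightarrow> 'a pair_pre_digraph \<Rightarrow> 'b pair_pre_digraph \<Rightarrow> bool" where
  "distinguishes \<phi> G G' \<longleftrightarrow> closed_formula \<phi> \<and> true_on \<phi> G \<and> \<not> true_on \<phi> G'"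

text \<open>The minimum exists for non-isomorphic graphs, see \<open>dist_depth_attained\<close>.\<close>

definition dist_depth :: "'a pair_pre_digraph \<Rightarrow> 'b pair_pre_digraph \<Rightarrow> nat" where
  "dist_depth G G' = (LEAST k. \<exists>\<phi>. distinguishes \<phi> G G' \<and> quantifier_rank \<phi> = k)"


subsection \<open>Non-isomorphic graphs are distinguishable\<close>

lemma digraph_iso_with_projI:
  assumes "pair_graph G" "pair_graph G'" and f: "bij_betw f (pverts G) (pverts G')"
    and adj: "\<And>u v. \<lbrakk>u \<in> pverts G; v \<in> pverts G\<rbrakk> \<Longrightarrow> (u, v) \<in> parcs G \<longleftrightarrow> (f u, f v) \<in> parcs G'"
  shows "digraph_iso (with_proj G) (with_proj G')"
proof -
  interpret G: pair_graph G by fact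
  interpret G': pair_graph G' by fact
  let ?h = "\<lparr>iso_verts = f, iso_arcs = map_prod f f, iso_head = snd, iso_tail = fst\<rparr>"
  have inj: "inj_on f (pverts G)" and im: "f ` pverts G = pverts G'"
    using f by (auto simp: bij_betw_def)
  have "inj_on (map_prod f f) (parcs G)"
    by (rule inj_on_subset[OF map_prod_inj_on[OF inj inj]]) (auto dest: G.in_arcsD1 G.in_arcsD2)
  then have 1: "G.digraph_isomorphism ?h"
    unfolding G.digraph_isomorphism_def using inj by (auto intro: G.wf_digraph)
  have "map_prod f f ` parcs G = parcs G'"
  proof
    show "map_prod f f ` parcs G \<subseteq> parcs G'"
      using adj by (auto dest: G.in_arcsD1 G.in_arcsD2)
    show "parcs G' \<subseteq> map_prod f f ` parcs G"
    proof
      fix a assume a: "a \<in> parcs G'"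
      obtain x y where xy: "a = (x, y)" by (cases a)
      then have "x \<in> f ` pverts G" "y \<in> f ` pverts G"
        using a im G'.in_arcsD1 G'.in_arcsD2 by auto
      then obtain u v where "u \<in> pverts G" "v \<in> pverts G" "x = f u" "y = f v" by auto
      then show "a \<in> map_prod f f ` parcs G" using a xy adj by (auto intro!: rev_image_eqI)
    qed
  qed
  then have "with_proj G' = app_iso ?h (with_proj G)"
    using im by (simp add: with_proj_def app_iso_def)
  with 1 show ?thesis unfolding digraph_iso_def by blast
qed

abbreviation (input) "Truth \<equiv> All 0 (Eq 0 0)"

lemma sat_foldr_Conj: "sat G e (foldr Conj \<phi>s Truth) \<longleftrightarrow> (\<forall>\<phi> \<in> set \<phi>s. sat G e \<phi>)"
  by (induction \<phi>s) auto

lemma sat_foldr_Disj: "sat G e (foldr Disj \<phi>s (Neg Truth)) \<longleftrightarrow> (\<exists>\<phi> \<in> set \<phi>s. sat G e \<phi>)"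
  by (induction \<phi>s) auto

lemma sat_foldr_Ex: "sat G e (foldr Ex xs \<phi>) \<longleftrightarrow>
  (\<exists>e'. (\<forall>x. x \<notin> set xs \<longrightarrow> e' x = e x) \<and> (\<forall>x \<in> set xs. e' x \<in> pverts G) \<and> sat G e' \<phi>)"
proof (induction xs arbitrary: e)
  case Nil
  have "e' = e" if "\<forall>x. e' x = e x" for e' using that by auto
  then show ?case by auto
next
  case (Cons y xs)
  show ?case (is "?L \<longleftrightarrow> ?R")
  proof
    assume ?L
    then obtain v e' where v: "v \<in> pverts G"
      and e': "\<forall>x. x \<notin> set xs \<longrightarrow> e' x = (e(y := v)) x"
        "\<forall>x \<in> set xs. e' x \<in> pverts G" "sat G e' \<phi>"
      using Cons by auto
    have "e' y \<in> pverts G" using v e' by (cases "y \<in> set xs") auto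
    with e' show ?R by (intro exI[of _ e']) auto
  next
    assume ?R
    then obtain e' where e': "\<forall>x. x \<notin> set (y # xs) \<longrightarrow> e' x = e x"
        "\<forall>x \<in> set (y # xs). e' x \<in> pverts G" "sat G e' \<phi>" by blast
    then have "sat G (e(y := e' y)) (foldr Ex xs \<phi>)"
      unfolding Cons by (intro exI[of _ e']) auto
    with e' show ?L by auto
  qed
qed

lemma free_vars_foldr_Conj: "free_vars (foldr Conj \<phi>s Truth) = (\<Union>\<phi> \<in> set \<phi>s. free_vars \<phi>)"
  by (induction \<phi>s) auto

lemma free_vars_foldr_Disj:
  "free_vars (foldr Disj \<phi>s (Neg Truth)) = (\<Union>\<phi> \<in> set \<phi>s. free_vars \<phi>)"
  by (induction \<phi>s) auto

lemma free_vars_foldr_Ex: "free_vars (foldr Ex xs \<phi>) = free_vars \<phi> - set xs"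
  by (induction xs) auto

lemma ex_distinguishes:
  assumes "pair_graph G" "pair_graph G'" "\<not> digraph_iso (with_proj G) (with_proj G')"
  shows "\<exists>\<phi>. distinguishes \<phi> G G'"
proof -
  interpret G: pair_graph G by fact
  interpret G': pair_graph G' by fact
  obtain vs where vs: "set vs = pverts G" "distinct vs"
    using finite_distinct_list G.pair_finite_verts by blast
  define n where "n = length vs"
  define lit where "lit i j = (if (vs ! i, vs ! j) \<in> parcs G then Adj i j else Neg (Adj i j))" for i j
  define neq where "neq i j = (if i = j then Truth else Neg (Eq i j))" for i j
  define cover where "cover = All n (foldr Disj (map (Eq n) [0..<n]) (Neg Truth))"
  define diagram where "diagram = Conj cover
    (foldr Conj (map (\<lambda>(i, j). Conj (lit i j) (neq i j)) (List.product [0..<n] [0..<n])) Truth)"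
  define \<phi> where "\<phi> = foldr Ex [0..<n] diagram"
  have diagram: "sat H e diagram \<longleftrightarrow> (\<forall>v \<in> pverts H. \<exists>i < n. v = e i) \<and>
    (\<forall>i < n. \<forall>j < n. ((e i, e j) \<in> parcs H \<longleftrightarrow> (vs ! i, vs ! j) \<in> parcs G) \<and> (e i = e j \<longrightarrow> i = j))"
    for H :: "'c pair_pre_digraph" and e
  proof -
    have c: "sat H e cover \<longleftrightarrow> (\<forall>v \<in> pverts H. \<exists>i < n. v = e i)"
      unfolding cover_def sat.simps(7) sat_foldr_Disj by (force simp: Bex_def)
    have l: "sat H e (lit i j) \<longleftrightarrow> ((e i, e j) \<in> parcs H \<longleftrightarrow> (vs ! i, vs ! j) \<in> parcs G)" for i j
      by (simp add: lit_def)
    have q: "sat H e (neq i j) \<longleftrightarrow> (e i = e j \<longrightarrow> i = j)" for i j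
      by (simp add: neq_def)
    show ?thesis
      unfolding diagram_def sat.simps(4) sat_foldr_Conj c by (auto simp: l q)
  qed
  have "free_vars diagram \<subseteq> {..<n}"
    unfolding diagram_def cover_def free_vars.simps free_vars_foldr_Conj free_vars_foldr_Disj
    by (auto simp: lit_def neq_def split: if_splits)
  then have closed: "closed_formula \<phi>"
    by (auto simp: closed_formula_def \<phi>_def free_vars_foldr_Ex)
  have "sat G e \<phi>" for e
  proof -
    have nth: "vs ! i \<in> pverts G" if "i < n" for i
      using that vs nth_mem unfolding n_def by metis
    have surj: "\<exists>i < n. v = vs ! i" if "v \<in> pverts G" for v
      using that vs unfolding n_def by (metis in_set_conv_nth)
    have inj: "i = j" if "i < n" "j < n" "vs ! i = vs ! j" for i j
      using that vs nth_eq_iff_index_eq unfolding n_def by metis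
    show ?thesis unfolding \<phi>_def sat_foldr_Ex diagram
      by (intro exI[of _ "\<lambda>i. if i < n then vs ! i else e i"]) (use nth surj inj in auto)
  qed
  moreover have "\<not> sat G' e \<phi>" for e
  proof
    assume "sat G' e \<phi>"
    then obtain e where "\<forall>i \<in> set [0..<n]. e i \<in> pverts G'" "sat G' e diagram"
      unfolding \<phi>_def sat_foldr_Ex by blast
    then have e: "\<forall>i < n. e i \<in> pverts G'" "\<forall>v \<in> pverts G'. \<exists>i < n. v = e i"
      "\<And>i j. i < n \<Longrightarrow> j < n \<Longrightarrow> (e i, e j) \<in> parcs G' \<longleftrightarrow> (vs ! i, vs ! j) \<in> parcs G"
      "\<And>i j. i < n \<Longrightarrow> j < n \<Longrightarrow> e i = e j \<Longrightarrow> i = j"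
      unfolding diagram by simp_all
    have b: "bij_betw (\<lambda>i. vs ! i) {..<n} (pverts G)"
      using vs by (simp add: bij_betw_nth n_def)
    have b': "bij_betw e {..<n} (pverts G')"
      unfolding bij_betw_def inj_on_def using e by blast
    define g where "g = the_inv_into {..<n} (\<lambda>i. vs ! i)"
    have g: "bij_betw g (pverts G) {..<n}"
      unfolding g_def by (rule bij_betw_the_inv_into[OF b])
    have gv: "g v < n" "vs ! g v = v" if "v \<in> pverts G" for v
      using that bij_betwE[OF g] f_the_inv_into_f_bij_betw[OF b] by (auto simp: g_def)
    have "digraph_iso (with_proj G) (with_proj G')"
    proof (rule digraph_iso_with_projI[OF assms(1,2)])
      show "bij_betw (e \<circ> g) (pverts G) (pverts G')" by (rule bij_betw_trans[OF g b'])
      show "(u, v) \<in> parcs G \<longleftrightarrow> ((e \<circ> g) u, (e \<circ> g) v) \<in> parcs G'"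
        if "u \<in> pverts G" "v \<in> pverts G" for u v
        using that e(3)[of "g u" "g v"] gv by simp
    qed
    with assms show False by simp
  qed
  ultimately show ?thesis
    using closed unfolding distinguishes_def true_on_def by blast
qed

lemma dist_depth_attained:
  assumes "pair_graph G" "pair_graph G'" "\<not> digraph_iso (with_proj G) (with_proj G')"
  shows "\<exists>\<phi>. distinguishes \<phi> G G' \<and> quantifier_rank \<phi> = dist_depth G G'"
proof -
  have "\<exists>k \<phi>. distinguishes \<phi> G G' \<and> quantifier_rank \<phi> = k"
    using ex_distinguishes[OF assms] by blast
  then show ?thesis unfolding dist_depth_def by (rule LeastI_ex)
qed

end

theory Submission
  imports Defs
begin

text \<open>The proof plays the Ehrenfeucht game. Adding a vertex to a set \<open>X\<close> refines the partition of the
  vertices according to their equality and adjacency type over \<open>X\<close>. Choose \<open>X\<close> of maximal size among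
  the sets with at least \<open>2|X| + 1\<close> types. Then \<open>|X| \<le> (n - 1) / 2\<close>, and a vertex of a class with
  at least two elements does not split any class, so that adjacency between such classes is constant.
  Spoiler selects \<open>X\<close> and has at least two moves left. These suffice to check that the classes of both
  graphs correspond to each other, so that the graphs are isomorphic unless some class, refined by its
  adjacency to the one-element classes, has different sizes in \<open>G\<close> and \<open>G'\<close>. As the orders agree, one
  refined class is then smaller in \<open>G\<close> and another one is smaller in \<open>G'\<close>. Since there are at least
  \<open>2|X| + 1\<close> types, the smaller one is so small that Spoiler can exhaust it.\<close>

subsection \<open>The Ehrenfeucht game\<close>

definition partial_iso ::
    "'a pair_pre_digraph \<Rightarrow> 'b pair_pre_digraph \<Rightarrow> ('a \<times> 'b) set \<Rightarrow> bool" where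
  "partial_iso G G' S \<longleftrightarrow> (\<forall>u v u' v'. (u, v) \<in> S \<longrightarrow> (u', v') \<in> S \<longrightarrow>
     (u = u' \<longleftrightarrow> v = v') \<and> ((u, u') \<in> parcs G \<longleftrightarrow> (v, v') \<in> parcs G'))"

text \<open>A position is the set of the pairs selected so far, and \<open>k\<close> rounds are left to play.\<close>

primrec duplicator ::
    "'a pair_pre_digraph \<Rightarrow> 'b pair_pre_digraph \<Rightarrow> nat \<Rightarrow> ('a \<times> 'b) set \<Rightarrow> bool" where
  "duplicator G G' 0 S \<longleftrightarrow> partial_iso G G' S"
| "duplicator G G' (Suc k) S \<longleftrightarrow> partial_iso G G' S \<and>
     (\<forall>u \<in> pverts G. \<exists>v \<in> pverts G'. duplicator G G' k (insert (u, v) S)) \<and>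
     (\<forall>v \<in> pverts G'. \<exists>u \<in> pverts G. duplicator G G' k (insert (u, v) S))"

lemma partial_isoD:
  assumes "partial_iso G G' S" "(u, v) \<in> S" "(u', v') \<in> S"
  shows "u = u' \<longleftrightarrow> v = v'" and "(u, u') \<in> parcs G \<longleftrightarrow> (v, v') \<in> parcs G'"
  using assms unfolding partial_iso_def by blast+

lemma partial_iso_imp_inj_on:
  assumes "partial_iso G G' S" "\<And>x. x \<in> A \<Longrightarrow> (x, f x) \<in> S"
  shows "inj_on f A"
proof (rule inj_onI)
  fix x y assume "x \<in> A" "y \<in> A" "f x = f y"
  with partial_isoD(1)[OF assms(1) assms(2)[of x] assms(2)[of y]] show "x = y" by simp
qed

lemma partial_iso_converse: "partial_iso G' G (S\<inverse>) \<longleftrightarrow> partial_iso G G' S"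
  unfolding partial_iso_def converse_iff by (intro iffI allI impI) simp_all

text \<open>The game does not favour either graph. Hence \<open>duplicator_play\<close>, stated for
  moves in \<open>G\<close>, also serves when Spoiler moves in \<open>G'\<close>.\<close>

lemma duplicator_converse: "duplicator G' G k (S\<inverse>) \<longleftrightarrow> duplicator G G' k S"
proof (induction k arbitrary: S)
  case (Suc k)
  have "insert (v, u) (S\<inverse>) = (insert (u, v) S)\<inverse>" for u v by auto
  then show ?case by (auto simp: Suc partial_iso_converse)
qed (simp add: partial_iso_converse)

lemma duplicator_imp_partial_iso: "duplicator G G' k S \<Longrightarrow> partial_iso G G' S"
  by (cases k) auto

lemma duplicator_mono: "duplicator G G' k S \<Longrightarrow> T \<subseteq> S \<Longrightarrow> duplicator G G' k T"
proof (induction k arbitrary: S T)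
  case 0
  then show ?case unfolding duplicator.simps partial_iso_def by fast
next
  case (Suc k)
  have "partial_iso G G' T" using Suc.prems unfolding duplicator.simps partial_iso_def by fast
  moreover have "insert p T \<subseteq> insert p S" for p using Suc.prems by auto
  ultimately show ?case using Suc.IH Suc.prems(1) unfolding duplicator.simps by meson
qed

lemma duplicator_Suc_imp: "duplicator G G' (Suc k) S \<Longrightarrow> duplicator G G' k S"
proof (induction k arbitrary: S)
  case (Suc k)
  then show ?case unfolding duplicator.simps(2)[of _ _ _ S] by meson
qed simp

lemma duplicator_le: "k \<le> l \<Longrightarrow> duplicator G G' l S \<Longrightarrow> duplicator G G' k S"
  by (induction l rule: dec_induct) (auto dest: duplicator_Suc_imp simp del: duplicator.simps)

text \<open>Spoiler spends one round on each element of \<open>A\<close>, and \<open>f\<close>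
  collects the answers. Keeping \<open>k\<close> arbitrary in the induction reserves the round for
  the last element.\<close>

lemma duplicator_play:
  assumes "finite A" "A \<subseteq> pverts G" "duplicator G G' (k + card A) S"
  shows "\<exists>f. f ` A \<subseteq> pverts G' \<and> duplicator G G' k (S \<union> (\<lambda>u. (u, f u)) ` A)"
  using assms
proof (induction A arbitrary: k rule: finite_induct)
  case (insert a A)
  then have "duplicator G G' (Suc k + card A) S" by simp
  then obtain f where f: "f ` A \<subseteq> pverts G'"
      "duplicator G G' (Suc k) (S \<union> (\<lambda>u. (u, f u)) ` A)"
    using insert.IH[of "Suc k"] insert.prems by blast
  then obtain v where v: "v \<in> pverts G'"
      "duplicator G G' k (insert (a, v) (S \<union> (\<lambda>u. (u, f u)) ` A))"
    using insert.prems by auto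
  have "S \<union> (\<lambda>u. (u, (f(a := v)) u)) ` insert a A = insert (a, v) (S \<union> (\<lambda>u. (u, f u)) ` A)"
    using insert.hyps by auto
  then show ?case using f v insert.hyps
    by (intro exI[of _ "f(a := v)"]) auto
qed auto

text \<open>Free variables are confined to those below \<open>m\<close>, so that \<open>m\<close>
  itself is fresh and can name the next selected pair.\<close>

definition fo_equiv ::
    "'a pair_pre_digraph \<Rightarrow> 'b pair_pre_digraph \<Rightarrow> nat \<Rightarrow> nat \<Rightarrow> (nat \<Rightarrow> 'a) \<Rightarrow> (nat \<Rightarrow> 'b) \<Rightarrow> bool" where
  "fo_equiv G G' k m e e' \<longleftrightarrow> (\<forall>\<phi>. free_vars \<phi> \<subseteq> {..<m} \<longrightarrow> quantifier_rank \<phi> \<le> k \<longrightarrow>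
     (sat G e \<phi> \<longleftrightarrow> sat G' e' \<phi>))"

lemma fo_equiv_sym: "fo_equiv G G' k m e e' \<Longrightarrow> fo_equiv G' G k m e' e"
  unfolding fo_equiv_def by blast

lemma sat_foldr_Conj_base: "sat G e (foldr Conj \<phi>s \<psi>) \<longleftrightarrow> sat G e \<psi> \<and> (\<forall>\<phi> \<in> set \<phi>s. sat G e \<phi>)"
  by (induction \<phi>s) auto

text \<open>If every answer \<open>v\<close> fails, each has a formula of rank at most
  \<open>k\<close> true for \<open>u\<close> and false for \<open>v\<close>. As \<open>G'\<close> is
  finite, their conjunction is a formula; existentially quantified, it separates the two assignments
  at rank \<open>Suc k\<close>.\<close>

lemma fo_equiv_forth:
  assumes fin: "finite (pverts G')" and equiv: "fo_equiv G G' (Suc k) m e e'" and u: "u \<in> pverts G"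
  shows "\<exists>v \<in> pverts G'. fo_equiv G G' k (Suc m) (e(m := u)) (e'(m := v))"
proof (rule ccontr)
  assume neg: "\<not> ?thesis"
  have "\<exists>\<phi>. free_vars \<phi> \<subseteq> {..<Suc m} \<and> quantifier_rank \<phi> \<le> k \<and>
      sat G (e(m := u)) \<phi> \<and> \<not> sat G' (e'(m := v)) \<phi>" if v: "v \<in> pverts G'" for v
  proof -
    obtain \<phi> where \<phi>: "free_vars \<phi> \<subseteq> {..<Suc m}" "quantifier_rank \<phi> \<le> k"
        "sat G (e(m := u)) \<phi> \<noteq> sat G' (e'(m := v)) \<phi>"
      using neg v unfolding fo_equiv_def by blast
    show ?thesis
    proof (cases "sat G (e(m := u)) \<phi>")
      case True
      then show ?thesis using \<phi> by blast
    next
      case False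
      then show ?thesis using \<phi> by (intro exI[of _ "Neg \<phi>"]) auto
    qed
  qed
  then obtain \<phi> where \<phi>: "\<And>v. v \<in> pverts G' \<Longrightarrow> free_vars (\<phi> v) \<subseteq> {..<Suc m} \<and>
      quantifier_rank (\<phi> v) \<le> k \<and> sat G (e(m := u)) (\<phi> v) \<and> \<not> sat G' (e'(m := v)) (\<phi> v)"
    by metis
  obtain vs where vs: "set vs = pverts G'" using fin finite_list by blast
  \<comment> \<open>The conjunction ends in \<open>Eq m m\<close> because \<open>Truth\<close>
    contains a quantifier and would raise the rank when \<open>k = 0\<close>.\<close>
  define conj where "conj ws = foldr Conj (map \<phi> ws) (Eq m m)" for ws
  have "free_vars (conj ws) \<subseteq> {..<Suc m} \<and> quantifier_rank (conj ws) \<le> k"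
    if "set ws \<subseteq> pverts G'" for ws
    using that by (induction ws) (use \<phi> in \<open>auto simp: conj_def\<close>)
  then have "free_vars (Ex m (conj vs)) \<subseteq> {..<m}" "quantifier_rank (Ex m (conj vs)) \<le> Suc k"
    using vs by (fastforce simp: less_Suc_eq)+
  moreover have "sat G e (Ex m (conj vs))"
    using u \<phi> vs by (auto simp: conj_def sat_foldr_Conj_base)
  moreover have "\<not> sat G' e' (Ex m (conj vs))"
    using \<phi> vs by (auto simp: conj_def sat_foldr_Conj_base)
  ultimately show False using equiv unfolding fo_equiv_def by blast
qed

lemma fo_equiv_imp_duplicator:
  assumes "finite (pverts G)" "finite (pverts G')" "fo_equiv G G' k m e e'"
  shows "duplicator G G' k ((\<lambda>i. (e i, e' i)) ` {..<m})"
  using assms(3)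
proof (induction k arbitrary: m e e')
  have iso: "partial_iso G G' ((\<lambda>i. (e i, e' i)) ` {..<m})" if "fo_equiv G G' k m e e'" for k m e e'
  proof -
    have "(e i = e j \<longleftrightarrow> e' i = e' j) \<and> ((e i, e j) \<in> parcs G \<longleftrightarrow> (e' i, e' j) \<in> parcs G')"
      if "i < m" "j < m" for i j
      using \<open>fo_equiv G G' k m e e'\<close>[unfolded fo_equiv_def, rule_format, of "Eq i j"]
        \<open>fo_equiv G G' k m e e'\<close>[unfolded fo_equiv_def, rule_format, of "Adj i j"] that by simp
    then show ?thesis unfolding partial_iso_def by auto
  qed
  {
    case 0
    then show ?case using iso by simp
  next
    case (Suc k)
    have upd: "(\<lambda>i. ((e(m := u)) i, (e'(m := v)) i)) ` {..<Suc m} =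
        insert (u, v) ((\<lambda>i. (e i, e' i)) ` {..<m})" for u v
      by (auto simp: lessThan_Suc)
    have "\<exists>v \<in> pverts G'. duplicator G G' k (insert (u, v) ((\<lambda>i. (e i, e' i)) ` {..<m}))"
      if "u \<in> pverts G" for u
      using fo_equiv_forth[OF assms(2) Suc.prems that] Suc.IH unfolding upd[symmetric] by blast
    moreover have "\<exists>u \<in> pverts G. duplicator G G' k (insert (u, v) ((\<lambda>i. (e i, e' i)) ` {..<m}))"
      if "v \<in> pverts G'" for v
      using fo_equiv_forth[OF assms(1) fo_equiv_sym[OF Suc.prems] that] Suc.IH fo_equiv_sym
      unfolding upd[symmetric] by blast
    ultimately show ?case using iso[OF Suc.prems] by simp
  }
qed

lemma duplicator_if_not_distinguished:
  assumes "finite (pverts G)" "finite (pverts G')"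
    and "\<And>\<phi>. distinguishes \<phi> G G' \<Longrightarrow> k < quantifier_rank \<phi>"
  shows "duplicator G G' k {}"
proof -
  fix e :: "nat \<Rightarrow> 'a" and e' :: "nat \<Rightarrow> 'b"
  have "sat G' e' \<phi>" if "closed_formula \<phi>" "quantifier_rank \<phi> \<le> k" "sat G e \<phi>" for \<phi>
    using that assms(3)[of \<phi>] true_on_iff[of \<phi> G e] true_on_iff[of \<phi> G' e']
    unfolding distinguishes_def by fastforce
  \<comment> \<open>\<open>distinguishes\<close> is one-sided; the negation, of equal rank, gives
    the other direction.\<close>
  from this this[of "Neg _"] have "fo_equiv G G' k 0 e e'"
    unfolding fo_equiv_def by (auto simp: closed_formula_def)
  from fo_equiv_imp_duplicator[OF assms(1,2) this] show ?thesis by simp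
qed

subsection \<open>Vertex types over a set of vertices\<close>

text \<open>The indices in \<open>X\<close> are kept apart from the vertices they name through
  \<open>f\<close>. Thus types in \<open>G\<close> (with \<open>id\<close>) and types in
  \<open>G'\<close> (with Duplicator's answers as \<open>f\<close>) can be compared.\<close>

definition vertex_type :: "'a pair_pre_digraph \<Rightarrow> 'i set \<Rightarrow> ('i \<Rightarrow> 'a) \<Rightarrow> 'a \<Rightarrow> 'i set \<times> 'i set" where
  "vertex_type G X f u = ({x \<in> X. f x = u}, {x \<in> X. (f x, u) \<in> parcs G})"

definition num_types :: "'a pair_pre_digraph \<Rightarrow> 'a set \<Rightarrow> nat" where
  "num_types G X = card (vertex_type G X id ` pverts G)"

lemma partial_iso_vertex_type_eq:
  assumes "partial_iso G G' (insert (u, v) ((\<lambda>x. (x, f x)) ` X))"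
  shows "vertex_type G X id u = vertex_type G' X f v"
proof -
  have "x = u \<longleftrightarrow> f x = v" "(x, u) \<in> parcs G \<longleftrightarrow> (f x, v) \<in> parcs G'" if "x \<in> X" for x
    using partial_isoD[OF assms, of x "f x" u v] that by simp_all
  then show ?thesis unfolding vertex_type_def by auto
qed

text \<open>Two types are gained: \<open>u\<close> becomes a class of its own while
  \<open>u2\<close> stays behind, and \<open>w\<close> is separated from \<open>w'\<close>.
  Formally, restricting new types to \<open>X\<close> still yields every old type after the new
  types of \<open>u\<close> and \<open>w'\<close> are discarded.\<close>

lemma num_types_insert_ge:
  assumes fin: "finite (pverts G)"
    and V: "u \<in> pverts G" "u2 \<in> pverts G" "w \<in> pverts G" "w' \<in> pverts G"
    and u2: "u2 \<noteq> u" "vertex_type G X id u2 = vertex_type G X id u"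
    and w: "w \<noteq> u" "w' \<noteq> u" "vertex_type G X id w = vertex_type G X id w'"
    and split: "(u, w) \<in> parcs G" "(u, w') \<notin> parcs G"
  shows "num_types G X + 2 \<le> num_types G (insert u X)"
proof -
  let ?V = "pverts G" and ?t = "vertex_type G X id" and ?T = "vertex_type G (insert u X) id"
  define forget where "forget \<tau> = (fst \<tau> \<inter> X, snd \<tau> \<inter> X)" for \<tau> :: "'a set \<times> 'a set"
  have forget: "forget (?T v) = ?t v" for v
    unfolding forget_def vertex_type_def by auto
  have u_iff: "u \<in> fst (?T v) \<longleftrightarrow> v = u" for v
    unfolding vertex_type_def by auto
  have ww': "?T w \<noteq> ?T w'"
    using split unfolding vertex_type_def by auto
  have uw: "?T w \<noteq> ?T u" "?T w' \<noteq> ?T u" "?T u2 \<noteq> ?T u"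
    using u_iff[of u] u_iff[of w] u_iff[of w'] u_iff[of u2] w u2 by auto
  let ?R = "?T ` ?V - {?T u, ?T w'}"
  have "?t v \<in> forget ` ?R" if v: "v \<in> ?V" for v
  proof -
    have "?t w \<in> forget ` ?R"
      using ww' uw V forget by (intro rev_image_eqI[of "?T w"]) auto
    \<comment> \<open>The old type of \<open>u\<close> is represented by \<open>u2\<close>, unless
      \<open>u2\<close> has the discarded type of \<open>w'\<close>; then it is the old type of
      \<open>w\<close>.\<close>
    moreover have "?t u \<in> forget ` ?R" if "?t u \<noteq> ?t w"
    proof -
      have "?T u2 \<noteq> ?T w'" using that forget u2 w by metis
      then show ?thesis
        using uw V forget u2 by (intro rev_image_eqI[of "?T u2"]) auto
    qed
    moreover have "?t v \<in> forget ` ?R" if "?T v \<noteq> ?T u" "?T v \<noteq> ?T w'"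
      using that v forget by (intro rev_image_eqI[of "?T v"]) auto
    moreover have "?t v = ?t u" if "?T v = ?T u" using that forget by metis
    moreover have "?t v = ?t w" if "?T v = ?T w'" using that forget w by metis
    ultimately show ?thesis by metis
  qed
  then have "card (?t ` ?V) \<le> card (forget ` ?R)"
    using fin by (intro card_mono) auto
  also have "\<dots> \<le> card ?R" using fin by (intro card_image_le) auto
  also have "\<dots> = card (?T ` ?V) - 2"
    using V uw(2) fin by (subst card_Diff_subset) auto
  finally have "card (?t ` ?V) \<le> card (?T ` ?V) - 2" .
  moreover have "card {?T u, ?T w'} \<le> card (?T ` ?V)"
    using V fin by (intro card_mono) auto
  ultimately show ?thesis using uw(2) unfolding num_types_def by auto
qed

text \<open>The empty set has one type, so it qualifies. A gain of two types would match the growth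
  of the bound \<open>2 * card X + 1\<close> and contradict the maximality of
  \<open>card X\<close>.\<close>

lemma ex_saturated_set:
  assumes "finite (pverts G)" "pverts G \<noteq> {}"
  shows "\<exists>X \<subseteq> pverts G. 2 * card X + 1 \<le> num_types G X \<and>
    (\<forall>u \<in> pverts G. num_types G (insert u X) \<le> num_types G X + 1)"
proof -
  let ?P = "\<lambda>X. X \<subseteq> pverts G \<and> 2 * card X + 1 \<le> num_types G X"
  have "?P {}" using assms by (simp add: num_types_def card_gt_0_iff Suc_le_eq)
  moreover have "\<forall>X. ?P X \<longrightarrow> card X < Suc (card (pverts G))"
    using assms(1) card_mono less_Suc_eq_le by blast
  ultimately obtain X where X: "?P X" "\<And>Y. ?P Y \<Longrightarrow> card Y \<le> card X"
    using ex_has_greatest_nat[of ?P "{}" card "Suc (card (pverts G))"] by (metis less_or_eq_imp_le)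
  have "num_types G (insert u X) \<le> num_types G X + 1" if u: "u \<in> pverts G" for u
  proof (rule ccontr)
    assume *: "\<not> ?thesis"
    then have "u \<notin> X" by (auto simp: insert_absorb)
    moreover have "finite X" using X assms finite_subset by blast
    ultimately have c: "card (insert u X) = Suc (card X)" by simp
    with * X u have "?P (insert u X)" by auto
    from X(2)[OF this] c show False by simp
  qed
  with X show ?thesis by blast
qed

subsection \<open>Fibers\<close>

lemma card_eq_sum_fibers:
  assumes "finite A" "finite C" "f ` A \<subseteq> C"
  shows "card A = (\<Sum>c \<in> C. card {a \<in> A. f a = c})"
  using sum.group[OF assms, of "\<lambda>_. 1 :: nat"] by simp

text \<open>Otherwise no fiber of \<open>f\<close> would exceed that of \<open>g\<close> and one
  would be strictly smaller, so the sums of the fiber sizes would differ.\<close>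

lemma ex_opposite_fiber:
  assumes fin: "finite A" "finite B" and "card A = card B"
    and i: "card {a \<in> A. f a = i} < card {b \<in> B. g b = i}"
  shows "\<exists>j. card {b \<in> B. g b = j} < card {a \<in> A. f a = j}"
proof (rule ccontr)
  assume neg: "\<not> ?thesis"
  let ?C = "insert i (f ` A \<union> g ` B)"
  have "(\<Sum>c \<in> ?C. card {a \<in> A. f a = c}) < (\<Sum>c \<in> ?C. card {b \<in> B. g b = c})"
    using neg i fin by (intro sum_strict_mono_ex1) (auto simp: not_less)
  moreover have "card A = (\<Sum>c \<in> ?C. card {a \<in> A. f a = c})"
    using fin by (intro card_eq_sum_fibers) auto
  moreover have "card B = (\<Sum>c \<in> ?C. card {b \<in> B. g b = c})"
    using fin by (intro card_eq_sum_fibers) auto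
  ultimately show False using assms by simp
qed

lemma ex_bij_betw_fibers:
  assumes fin: "finite A" "finite B"
    and eq: "\<And>c. card {a \<in> A. f a = c} = card {b \<in> B. g b = c}"
  shows "\<exists>h. bij_betw h A B \<and> (\<forall>a \<in> A. g (h a) = f a)"
proof -
  have "\<exists>h. bij_betw h {a \<in> A. f a = c} {b \<in> B. g b = c}" for c
    using fin eq by (intro finite_same_card_bij) auto
  then obtain h where h: "\<And>c. bij_betw (h c) {a \<in> A. f a = c} {b \<in> B. g b = c}"
    using choice[of "\<lambda>c h. bij_betw h {a \<in> A. f a = c} {b \<in> B. g b = c}"] by blast
  have hB: "h (f a) a \<in> B" "g (h (f a) a) = f a" if "a \<in> A" for a
    using that bij_betwE[OF h[of "f a"]] by auto
  have "bij_betw (\<lambda>a. h (f a) a) A B"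
  proof (rule bij_betw_imageI)
    show "inj_on (\<lambda>a. h (f a) a) A"
    proof (rule inj_onI)
      fix a a' assume a: "a \<in> A" "a' \<in> A" "h (f a) a = h (f a') a'"
      then have "f a = f a'" using hB by metis
      then show "a = a'" using a h[of "f a"] by (auto simp: bij_betw_def inj_on_def)
    qed
    show "(\<lambda>a. h (f a) a) ` A = B"
    proof
      show "B \<subseteq> (\<lambda>a. h (f a) a) ` A"
      proof
        fix b assume "b \<in> B"
        then have "b \<in> h (g b) ` {a \<in> A. f a = g b}" using h[of "g b"] by (auto simp: bij_betw_def)
        then show "b \<in> (\<lambda>a. h (f a) a) ` A" by (auto intro: rev_image_eqI)
      qed
    qed (use hB in auto)
  qed
  with hB show ?thesis by blast
qed

text \<open>Each value of \<open>t\<close> other than \<open>i\<close> needs an element outside the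
  fiber of \<open>i\<close>; so many types leave little room for a single class.\<close>

lemma card_image_fiber_bound:
  assumes "finite V"
  shows "card (t ` V) + card {v \<in> V. t v = i} \<le> card V + 1"
proof -
  let ?C = "{v \<in> V. t v = i}"
  have "card (t ` V) \<le> card (insert i (t ` (V - ?C)))"
    using assms by (intro card_mono) auto
  also have "\<dots> \<le> Suc (card (t ` (V - ?C)))" by (rule card_insert_le_m1) auto
  also have "\<dots> \<le> Suc (card (V - ?C))" using assms by (simp add: card_image_le)
  also have "card (V - ?C) = card V - card ?C" using assms by (intro card_Diff_subset) auto
  finally show ?thesis using card_mono[of V ?C] assms by auto
qed

text \<open>Remove the fiber of \<open>i\<close>, which costs at most one value, and apply the bound
  for one fiber to the rest.\<close>

lemma card_image_two_fibers_bound: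
  assumes fin: "finite V" and "i \<noteq> j"
  shows "card (t ` V) + card {v \<in> V. t v = i} + card {v \<in> V. t v = j} \<le> card V + 2"
proof -
  let ?C = "{v \<in> V. t v = i}" and ?D = "{v \<in> V. t v = j}"
  have "card (t ` V) \<le> card (insert i (t ` (V - ?C)))"
    using fin by (intro card_mono) auto
  also have "\<dots> \<le> Suc (card (t ` (V - ?C)))" by (rule card_insert_le_m1) auto
  finally have "card (t ` V) \<le> Suc (card (t ` (V - ?C)))" .
  moreover have "card (t ` (V - ?C)) + card {v \<in> V - ?C. t v = j} \<le> card (V - ?C) + 1"
    using fin by (intro card_image_fiber_bound) auto
  moreover have "{v \<in> V - ?C. t v = j} = ?D" using assms by auto
  moreover have "card (V - ?C) = card V - card ?C" using fin by (intro card_Diff_subset) auto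
  ultimately show ?thesis using card_mono[of V ?C] fin by auto
qed

subsection \<open>Isomorphism of indistinguishable graphs\<close>

lemma duplicator_imp_digraph_iso:
  assumes G: "pair_graph G" and G': "pair_graph G'"
    and card_eq: "card (pverts G) = n" "card (pverts G') = n"
    and K: "n + 2 \<le> 2 * K" and dup: "duplicator G G' K {}"
  shows "digraph_iso (with_proj G) (with_proj G')"
proof -
  interpret G: pair_graph G by fact
  interpret G': pair_graph G' by fact
  let ?V = "pverts G" and ?V' = "pverts G'"
  have fin [simp]: "finite ?V" "finite ?V'" by auto
  have sym: "(u, v) \<in> parcs G \<longleftrightarrow> (v, u) \<in> parcs G" for u v
    using G.arcs_symmetric by blast
  have sym': "(u, v) \<in> parcs G' \<longleftrightarrow> (v, u) \<in> parcs G'" for u v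
    using G'.arcs_symmetric by blast
  have irr: "(u, u) \<notin> parcs G" for u using G.pair_no_loops[of "(u, u)"] by auto
  have irr': "(u, u) \<notin> parcs G'" for u using G'.pair_no_loops[of "(u, u)"] by auto
  show ?thesis
  proof (cases "n = 0")
    case True
    then have "?V = {}" "?V' = {}" using card_eq by auto
    then show ?thesis
      by (intro digraph_iso_with_projI[OF G G', of undefined]) (auto simp: bij_betw_def)
  next
    case False
    then have "?V \<noteq> {}" using card_eq by auto
    from ex_saturated_set[OF fin(1) this] obtain X where X: "X \<subseteq> ?V"
        "2 * card X + 1 \<le> num_types G X"
        "\<And>u. u \<in> ?V \<Longrightarrow> num_types G (insert u X) \<le> num_types G X + 1"
      by blast
    have "num_types G X \<le> n"
      unfolding num_types_def card_eq(1)[symmetric] by (rule card_image_le) simp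
    \<comment> \<open>From \<open>2 * card X + 1\<close> at most \<open>n\<close> and
      \<open>n + 2\<close> at most \<open>2 * K\<close> follows \<open>2 * card X + 3\<close> at
      most \<open>2 * K\<close>; parity gives the last unit.\<close>
    then have "card X + 2 \<le> K" using X(2) K by linarith
    define r where "r = K - card X"
    have r: "2 \<le> r" "K = r + card X" using \<open>card X + 2 \<le> K\<close> unfolding r_def by auto
    have "finite X" using X(1) fin finite_subset by blast
    with X(1) dup r obtain f where f: "f ` X \<subseteq> ?V'"
        "duplicator G G' r ((\<lambda>x. (x, f x)) ` X)"
      using duplicator_play[of X G G' r "{}"] by auto
    define S where "S = (\<lambda>x. (x, f x)) ` X"
    have S: "duplicator G G' r S" using f S_def by simp
    define t where "t = vertex_type G X id"
    define t' where "t' = vertex_type G' X f"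
    have t_eq: "t u = t' v" if "duplicator G G' k T" "insert (u, v) S \<subseteq> T" for u v k T
      unfolding t_def t'_def
      using duplicator_imp_partial_iso[OF duplicator_mono[OF that]]
      by (intro partial_iso_vertex_type_eq) (simp add: S_def)

    \<comment> \<open>Adjacency between classes with at least two elements\<close>
    define B where "B = {u \<in> ?V. \<forall>w \<in> ?V. t w = t u \<longrightarrow> w = u}"
    \<comment> \<open>A vertex outside \<open>B\<close> shares its class with some
      \<open>u2\<close>. If it also split a class, adding it to \<open>X\<close> would gain two
      types, against the choice of \<open>X\<close>.\<close>
    have uniform: "(u, w) \<in> parcs G \<longleftrightarrow> (u, w') \<in> parcs G"
      if V: "u \<in> ?V" "w \<in> ?V" "w' \<in> ?V" and u: "u \<notin> B" and w: "w \<noteq> u" "w' \<noteq> u" "t w = t w'"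
      for u w w'
    proof (rule ccontr)
      assume *: "\<not> ?thesis"
      obtain u2 where u2: "u2 \<in> ?V" "t u2 = t u" "u2 \<noteq> u" using u V unfolding B_def by blast
      have "num_types G X + 2 \<le> num_types G (insert u X)"
        using * num_types_insert_ge[of G u u2 w w' X] num_types_insert_ge[of G u u2 w' w X]
          V u2 w unfolding t_def by fastforce
      with X(3)[of u] V show False by simp
    qed
    have homogeneous: "(u, w) \<in> parcs G \<longleftrightarrow> (u1, w1) \<in> parcs G"
      if V: "u \<in> ?V" "w \<in> ?V" "u1 \<in> ?V" "w1 \<in> ?V" and B: "u \<notin> B" "w \<notin> B"
        and eq: "t u = t u1" "t w = t w1" and neq: "u \<noteq> w" "u1 \<noteq> w1" for u w u1 w1
    \<comment> \<open>The endpoints are exchanged one at a time, through the pair \<open>u\<close>,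
      \<open>w1\<close>. If these coincide, all four vertices have the same type, and
      \<open>w\<close> and \<open>u1\<close> are compared directly as neighbours of
      \<open>u\<close>.\<close>
    proof (cases "u = w1")
      case True
      then show ?thesis using uniform[of u w u1] that sym by metis
    next
      case False
      have "w1 \<notin> B" using B V eq unfolding B_def by (metis (mono_tags, lifting) mem_Collect_eq)
      then have "(w1, u) \<in> parcs G \<longleftrightarrow> (w1, u1) \<in> parcs G"
        using uniform[of w1 u u1] that False by blast
      moreover have "(u, w) \<in> parcs G \<longleftrightarrow> (u, w1) \<in> parcs G"
        using uniform[of u w w1] that False by blast
      ultimately show ?thesis using sym by blast
    qed
    \<comment> \<open>Spoiler plays \<open>v\<close> and \<open>z\<close> in the two remaining
      rounds. The answers have the types of \<open>u\<close> and \<open>w\<close> and reproduce the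
      adjacency of \<open>v\<close> and \<open>z\<close>, so \<open>homogeneous\<close>
      applies.\<close>
    have homogeneous': "(u, w) \<in> parcs G \<longleftrightarrow> (v, z) \<in> parcs G'"
      if V: "u \<in> ?V" "w \<in> ?V" "v \<in> ?V'" "z \<in> ?V'" and B: "u \<notin> B" "w \<notin> B"
        and eq: "t u = t' v" "t w = t' z" and neq: "u \<noteq> w" "v \<noteq> z" for u w v z
    proof -
      have "duplicator G G' (Suc (Suc 0)) S"
        using S r(1) by (intro duplicator_le[of "Suc (Suc 0)" r]) auto
      then obtain u1 where u1: "u1 \<in> ?V" "duplicator G G' (Suc 0) (insert (u1, v) S)"
        unfolding duplicator.simps(2)[of _ _ "Suc 0"] using V by blast
      then obtain w1 where w1: "w1 \<in> ?V" "duplicator G G' 0 (insert (w1, z) (insert (u1, v) S))"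
        unfolding duplicator.simps(2) using V by blast
      have types: "t u1 = t' v" "t w1 = t' z"
        using t_eq[OF w1(2), of u1 v] t_eq[OF w1(2), of w1 z] by blast+
      have iso: "partial_iso G G' (insert (w1, z) (insert (u1, v) S))" using w1(2) by simp
      have "u1 \<noteq> w1" "(u1, w1) \<in> parcs G \<longleftrightarrow> (v, z) \<in> parcs G'"
        using partial_isoD[OF iso, of u1 v w1 z] neq(2) by auto
      moreover have "(u, w) \<in> parcs G \<longleftrightarrow> (u1, w1) \<in> parcs G"
        using V B eq neq u1 w1 types \<open>u1 \<noteq> w1\<close> by (intro homogeneous) auto
      ultimately show ?thesis by blast
    qed

    text \<open>\<open>B\<close> consists of the one-element classes, \<open>P\<close> pairs them with their counterparts in \<open>G'\<close>, and
      \<open>d\<close>, \<open>d'\<close> are the refined types.\<close>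
    define P where "P = {(y, y') \<in> B \<times> ?V'. t y = t' y'}"
    define d where "d u = (t u, {p \<in> P. (fst p, u) \<in> parcs G})" for u
    define d' where "d' v = (t' v, {p \<in> P. (snd p, v) \<in> parcs G'})" for v
    \<comment> \<open>One spare round suffices: for a pair \<open>(y, y')\<close> in
      \<open>P\<close> Spoiler plays \<open>y'\<close>, and the only answer of the right type is
      \<open>y\<close>.\<close>
    have d_eq: "d u = d' v" if dup1: "duplicator G G' (Suc 0) (insert (u, v) S)" for u v
    proof -
      have "(y, u) \<in> parcs G \<longleftrightarrow> (y', v) \<in> parcs G'" if y: "(y, y') \<in> P" for y y'
      proof -
        have "y' \<in> ?V'" using y unfolding P_def by auto
        with dup1 obtain y2 where y2: "y2 \<in> ?V" "duplicator G G' 0 (insert (y2, y') (insert (u, v) S))"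
          by auto
        have "t y2 = t' y'" using t_eq[OF y2(2), of y2 y'] by blast
        then have "y2 = y" using y y2(1) unfolding P_def B_def by auto
        moreover have "partial_iso G G' (insert (y2, y') (insert (u, v) S))" using y2(2) by simp
        from partial_isoD(2)[OF this, of y2 y' u v]
        have "(y2, u) \<in> parcs G \<longleftrightarrow> (y', v) \<in> parcs G'" by simp
        ultimately show ?thesis by simp
      qed
      then show ?thesis using t_eq[OF dup1, of u v] unfolding d_def d'_def by auto
    qed
    have adj_eq: "(u, w) \<in> parcs G \<longleftrightarrow> (v, z) \<in> parcs G'"
      if V: "u \<in> ?V" "w \<in> ?V" "v \<in> ?V'" "z \<in> ?V'"
        and eq: "d u = d' v" "d w = d' z" and neq: "u \<noteq> w" "v \<noteq> z" for u w v z
    proof -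
      \<comment> \<open>If one endpoint lies in \<open>B\<close>, it forms a pair of
        \<open>P\<close> with its counterpart, and the refined type of the other endpoint records
        the adjacency.\<close>
      have *: "(y, x) \<in> parcs G \<longleftrightarrow> (y', x') \<in> parcs G'"
        if "y \<in> B" "y' \<in> ?V'" "d y = d' y'" "d x = d' x'" for x x' y y'
      proof -
        have "(y, y') \<in> P" using that unfolding P_def d_def d'_def by auto
        moreover have "(y, y') \<in> snd (d x) \<longleftrightarrow> (y, y') \<in> snd (d' x')" using that(4) by simp
        ultimately show ?thesis unfolding d_def d'_def by simp
      qed
      show ?thesis
      proof (cases "u \<in> B \<or> w \<in> B")
        case True
        then show ?thesis using *[of u v w z] *[of w z u v] V eq sym sym' by blast
      next
        case False
        then show ?thesis using homogeneous'[of u w v z] that unfolding d_def d'_def by auto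
      qed
    qed

    \<comment> \<open>Equality of the sizes of the refined classes\<close>
    have fibers_eq: "card {u \<in> ?V. d u = c} = card {v \<in> ?V'. d' v = c}" for c
    proof (rule ccontr)
      assume neq: "card {u \<in> ?V. d u = c} \<noteq> card {v \<in> ?V'. d' v = c}"
      have "card ?V = card ?V'" using card_eq by simp
      note opposite = ex_opposite_fiber[OF fin this] ex_opposite_fiber[OF fin(2,1) this[symmetric]]
      obtain i j where i: "card {u \<in> ?V. d u = i} < card {v \<in> ?V'. d' v = i}"
        and j: "card {v \<in> ?V'. d' v = j} < card {u \<in> ?V. d u = j}"
        using neq opposite(1)[of d c d'] opposite(2)[of d' c d] unfolding nat_neq_iff by blast
      define a where "a = card {u \<in> ?V. d u = i}"
      define b where "b = card {v \<in> ?V'. d' v = j}"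

      have play_i: "\<exists>h. inj_on h A \<and> h ` A \<subseteq> ?V \<and> (\<forall>v \<in> A. duplicator G G' k (insert (h v, v) S))"
        if A: "A \<subseteq> ?V'" "k + card A \<le> r" for A k
      proof -
        have "duplicator G' G (k + card A) (S\<inverse>)"
          unfolding duplicator_converse using duplicator_le[OF A(2) S] .
        from duplicator_play[OF _ A(1) this] A(1) obtain h where h: "h ` A \<subseteq> ?V"
            "duplicator G' G k (S\<inverse> \<union> (\<lambda>u. (u, h u)) ` A)"
          using finite_subset fin by metis
        have "inj_on h A"
          by (rule partial_iso_imp_inj_on[OF duplicator_imp_partial_iso[OF h(2)]]) simp
        moreover have "duplicator G G' k (insert (h v, v) S)" if "v \<in> A" for v
        proof -
          have "duplicator G' G k ((insert (h v, v) S)\<inverse>)"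
            using that by (intro duplicator_mono[OF h(2)]) auto
          then show ?thesis unfolding duplicator_converse .
        qed
        ultimately show ?thesis using h(1) by blast
      qed
      \<comment> \<open>With \<open>a + 2\<close> rounds Spoiler selects \<open>a + 1\<close>
        vertices of refined type \<open>i\<close> in \<open>G'\<close>. The round left over forces
        the answers into the fiber of \<open>i\<close> in \<open>G\<close>, which has only
        \<open>a\<close> elements.\<close>
      have ra: "r \<le> a + 1"
      proof (rule ccontr)
        assume *: "\<not> r \<le> a + 1"
        obtain A where A: "A \<subseteq> {v \<in> ?V'. d' v = i}" "card A = Suc a"
          unfolding a_def by (rule obtain_subset_with_card_n[OF Suc_leI[OF i]])
        then have "A \<subseteq> ?V'" "Suc 0 + card A \<le> r" using * by auto
        from play_i[OF this] obtain h where h: "inj_on h A" "h ` A \<subseteq> ?V"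
            "\<forall>v \<in> A. duplicator G G' (Suc 0) (insert (h v, v) S)" by blast
        have "h ` A \<subseteq> {u \<in> ?V. d u = i}" using h d_eq A(1) by fastforce
        from card_mono[OF _ this] have "card (h ` A) \<le> a" unfolding a_def by simp
        with card_image[OF h(1)] A(2) show False by simp
      qed
      \<comment> \<open>If the refined class is a whole class, the plain type already forces the
        answers into it, which saves the spare round.\<close>
      have ra': "r \<le> a" if full: "{u \<in> ?V. t u = fst i} = {u \<in> ?V. d u = i}"
      proof (rule ccontr)
        assume *: "\<not> r \<le> a"
        obtain A where A: "A \<subseteq> {v \<in> ?V'. d' v = i}" "card A = Suc a"
          unfolding a_def by (rule obtain_subset_with_card_n[OF Suc_leI[OF i]])
        then have "A \<subseteq> ?V'" "0 + card A \<le> r" using * by auto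
        from play_i[OF this] obtain h where h: "inj_on h A" "h ` A \<subseteq> ?V"
            "\<forall>v \<in> A. duplicator G G' 0 (insert (h v, v) S)" by blast
        have "t (h v) = fst i" if "v \<in> A" for v
          using t_eq[of 0 "insert (h v, v) S" "h v" v] h(3) A(1) that unfolding d'_def by fastforce
        then have "h ` A \<subseteq> {u \<in> ?V. d u = i}" using h(2) full by blast
        from card_mono[OF _ this] have "card (h ` A) \<le> a" unfolding a_def by simp
        with card_image[OF h(1)] A(2) show False by simp
      qed
      have rb: "r \<le> b + 1"
      proof (rule ccontr)
        assume *: "\<not> r \<le> b + 1"
        obtain A where A: "A \<subseteq> {u \<in> ?V. d u = j}" "card A = Suc b"
          unfolding b_def by (rule obtain_subset_with_card_n[OF Suc_leI[OF j]])
        have "finite A" using finite_subset[OF A(1)] by simp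
        moreover have "duplicator G G' (Suc 0 + card A) S"
          using * A(2) by (intro duplicator_le[OF _ S]) simp
        ultimately obtain h where h: "h ` A \<subseteq> ?V'"
            "duplicator G G' (Suc 0) (S \<union> (\<lambda>u. (u, h u)) ` A)"
          using duplicator_play[of A G G' "Suc 0" S] A(1) by blast
        have inj: "inj_on h A"
          by (rule partial_iso_imp_inj_on[OF duplicator_imp_partial_iso[OF h(2)]]) simp
        have "d u = d' (h u)" if "u \<in> A" for u
          using that by (intro d_eq duplicator_mono[OF h(2)]) auto
        then have "h ` A \<subseteq> {v \<in> ?V'. d' v = j}" using h(1) A(1) by fastforce
        from card_mono[OF _ this] have "card (h ` A) \<le> b" unfolding b_def by simp
        with card_image[OF inj] A(2) show False by simp
      qed

      let ?Ci = "{u \<in> ?V. t u = fst i}" and ?Cj = "{u \<in> ?V. t u = fst j}"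
      let ?Di = "{u \<in> ?V. d u = i}" and ?Dj = "{u \<in> ?V. d u = j}"
      have sub: "?Di \<subseteq> ?Ci" "?Dj \<subseteq> ?Cj" unfolding d_def by auto
      have types: "2 * card X + 1 \<le> card (t ` ?V)" using X(2) unfolding num_types_def t_def .
      show False
      \<comment> \<open>Both cases lead to \<open>2 * K\<close> at most \<open>n + 1\<close>. If
        \<open>i\<close> and \<open>j\<close> refine the same class, that class has at least
        \<open>(r - 1) + r\<close> elements; otherwise each of the two classes has at least
        \<open>r\<close>.\<close>
      proof (cases "fst i = fst j")
        case True
        have "i \<noteq> j" using i j by auto
        then have "card ?Di + card ?Dj = card (?Di \<union> ?Dj)"
          by (intro card_Un_disjoint[symmetric]) auto
        also have "\<dots> \<le> card ?Ci" using sub True by (intro card_mono) auto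
        finally show False
          using card_image_fiber_bound[OF fin(1), of t "fst i"] types ra rb K r j card_eq
          unfolding a_def b_def by linarith
      next
        case False
        have "card ?Dj \<le> card ?Cj" using sub by (intro card_mono) auto
        moreover have "r \<le> card ?Ci"
        \<comment> \<open>In \<open>G\<close> the fiber of \<open>i\<close> is the smaller one, so
          \<open>ra\<close> alone gives only \<open>r - 1\<close> elements. The missing one is a
          vertex of the class outside the fiber, or else \<open>ra'\<close> applies.\<close>
        proof (cases "?Ci = ?Di")
          case True
          then show ?thesis using ra' unfolding a_def by simp
        next
          case False
          then have "card ?Di < card ?Ci" using sub by (intro psubset_card_mono) auto
          then show ?thesis using ra unfolding a_def by simp
        qed
        ultimately show False
          using card_image_two_fibers_bound[OF fin(1) False, of t] types rb K r j card_eq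
          unfolding b_def by linarith
      qed
    qed
    from ex_bij_betw_fibers[OF fin fibers_eq] obtain h where h: "bij_betw h ?V ?V'"
        "\<forall>u \<in> ?V. d' (h u) = d u" by auto
    show ?thesis
    proof (rule digraph_iso_with_projI[OF G G' h(1)])
      fix u w assume uw: "u \<in> ?V" "w \<in> ?V"
      show "(u, w) \<in> parcs G \<longleftrightarrow> (h u, h w) \<in> parcs G'"
      proof (cases "u = w")
        case True
        then show ?thesis using irr irr' by simp
      next
        case False
        then have "h u \<noteq> h w" using h(1) uw by (auto simp: bij_betw_def inj_on_def)
        then show ?thesis using False uw h bij_betwE[OF h(1)] by (intro adj_eq) auto
      qed
    qed
  qed
qed

theorem theorem1p1:
  fixes G :: "'a pair_pre_digraph" and G' :: "'b pair_pre_digraph" and n :: nat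
  assumes "pair_graph G" and "pair_graph G'"
    and "card (pverts G) = n" and "card (pverts G') = n"
    and "\<not> digraph_iso (with_proj G) (with_proj G')"
  shows "real (dist_depth G G') \<le> (real n + 3) / 2"
proof (rule ccontr)
  assume *: "\<not> ?thesis"
  interpret G: pair_graph G by fact
  interpret G': pair_graph G' by fact
  \<comment> \<open>The depth is an integer, so exceeding \<open>(n + 3) / 2\<close> means exceeding
    its integer part \<open>K\<close>, which still satisfies \<open>n + 2\<close> at most
    \<open>2 * K\<close>.\<close>
  define K where "K = (n + 3) div 2"
  have "real (n + 3) < real (2 * dist_depth G G')" using * by simp
  then have "n + 3 < 2 * dist_depth G G'" by (simp only: of_nat_less_iff)
  then have "K < dist_depth G G'" unfolding K_def by linarith
  moreover have "dist_depth G G' \<le> quantifier_rank \<phi>" if "distinguishes \<phi> G G'" for \<phi>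
    unfolding dist_depth_def using that by (intro Least_le) blast
  ultimately have "K < quantifier_rank \<phi>" if "distinguishes \<phi> G G'" for \<phi>
    using that by fastforce
  then have "duplicator G G' K {}"
    by (intro duplicator_if_not_distinguished) auto
  moreover have "n + 2 \<le> 2 * K" unfolding K_def by linarith
  ultimately show False
    using duplicator_imp_digraph_iso assms by blast
qed

end
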